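(* Let $A \subset \mathbb{Z}^d$ be a finite set such that the lattice $\Lambda_{A-A}$ generated by $A-A=\{a-a' : a,a'\in A\}$ is $d$-dimensional. Then \[ N_{\operatorname{Kh}}(A) \leqslant \vert A\vert^2 \operatorname{Vol}^{\dagger, \max}(H(A)) - \vert A\vert + 1. \]
   Context: For a positive integer $N$, $NA=\{a_1+\cdots+a_N : a_i\in A\}$. By Khovanskii's theorem there is a polynomial $P_A\in\mathbb{Q}[X]$ and a threshold beyond which $|NA|=P_A(N)$; $N_{\operatorname{Kh}}(A)$ denotes the least positive integer $N_0$ such that there is a polynomial $P_A\in\mathbb{Q}[X]$ with $|NA|=P_A(N)$ for all integers $N\geqslant N_0$. $H(A)$ is the convex hull of $A$. Writing $A=\{a_1,\dots,a_\ell\}$, \[ \operatorname{Vol}^{\dagger,\max}(H(A)) := \max_{\{ i_0, i_1,\dots, i_{d}\}\subset \{1,\dots,\ell\}} \vert \det ( a_{i_1}-a_{i_0} , \dots , a_{i_{d}}-a_{i_0})\vert, \] where the maximum is over $(d+1)$-element index subsets. *)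

theory Defs
  imports
    "HOL-Analysis.Analysis"
    "HOL-Computational_Algebra.Polynomial"
    "HOL-Computational_Algebra.Group_Closure"
begin

definition sumset_mult :: "nat \<Rightarrow> 'a::comm_monoid_add set \<Rightarrow> 'a set" where
  "sumset_mult N A = {\<Sum>i<N. a i | a. \<forall>i<N. a i \<in> A}"

definition diff_lattice :: "(int ^ 'd) set \<Rightarrow> (int ^ 'd) set" where
  "diff_lattice A = group_closure {a - a' | a a'. a \<in> A \<and> a' \<in> A}"

text \<open>The dimension of a lattice in \<open>\<int>\<^sup>d\<close> is that of the real subspace of \<open>\<real>\<^sup>d\<close> it spans
  (\<^const>\<open>dim\<close> of a set is the dimension of its real span).\<close>

definition lattice_dim :: "(int ^ 'd) set \<Rightarrow> nat" where
  "lattice_dim L = dim ((\<lambda>x. (\<chi> i. real_of_int (x $ i)) :: real ^ 'd) ` L)"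

text \<open>This is an unspecified number if no such \<open>N\<^sub>0\<close> exists, which by Khovanskii's theorem cannot
  happen for finite \<open>A \<subseteq> \<int>\<^sup>d\<close>.\<close>

definition khovanskii_threshold :: "(int ^ 'd) set \<Rightarrow> nat" where
  "khovanskii_threshold A =
     (LEAST N\<^sub>0. N\<^sub>0 > 0 \<and>
        (\<exists>P :: rat poly. \<forall>N\<ge>N\<^sub>0. of_nat (card (sumset_mult N A)) = poly P (of_nat N)))"

text \<open>A choice of \<open>d + 1\<close> distinct elements of \<open>A\<close> is an injection \<open>a :: 'd option \<Rightarrow> int ^ 'd\<close> into
  \<open>A\<close>: the base point \<open>a\<^bsub>i\<^sub>0\<^esub>\<close> is \<open>a None\<close>, and \<open>a (Some c) - a None\<close> is column \<open>c\<close> of the matrix.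
  The ordering of the chosen points does not affect the absolute value of the determinant.
  The maximum is over a nonempty set only if \<open>A\<close> has at least \<open>d + 1\<close> elements.\<close>

definition vol_dagger_max :: "(int ^ 'd) set \<Rightarrow> int" where
  "vol_dagger_max A =
     Max {\<bar>det (\<chi> r c. (a (Some c) - a None) $ r)\<bar> | a :: 'd option \<Rightarrow> int ^ 'd.
            inj a \<and> range a \<subseteq> A}"

end

theory Submission
  imports Defs
begin

text \<open>Identify \<open>NA\<close> with the vectors \<open>m \<in> \<nat>\<^sup>A\<close> of degree \<open>N\<close> that are lexicographically minimal among
  those with the same degree and the same \<open>\<Sum>x. m x * x\<close>. The remaining vectors form an up-set,
  the exponents of the initial ideal of a homogeneous toric ideal. If \<open>m\<close> is a minimal element of it,
  with smaller partner \<open>m'\<close>, then \<open>m\<close> is the positive part of the integral affine relation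
  \<open>u = m - m'\<close>, which has no proper sign-compatible decomposition. Subtracting circuits from \<open>u\<close>
  kills at least one coordinate each time, and by Cramer's rule the circuits are integral with entries
  at most \<open>Vol\<close>, the maximal determinant; each is used with coefficient below 1, since otherwise it
  would split off. Hence all coordinates of \<open>m\<close> are at most \<open>M = |A| * Vol\<close>, and membership in the up-set
  depends only on the truncation \<open>min m M\<close>. A fibre of the truncation over \<open>c\<close> contributes
  a binomial coefficient which is polynomial for
  \<open>N > |A| * (M - 1) \<ge> (\<Sum>x. c x) - card {x. c x = M}\<close>.\<close>

section \<open>Counting exponent vectors\<close>

text \<open>Vectors are functions on the whole type; forcing them to vanish off \<open>A\<close>
  makes each degree finite and equality of vectors equality on \<open>A\<close>.\<close>

definition exps :: "'a set \<Rightarrow> nat \<Rightarrow> ('a \<Rightarrow> nat) set" where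
  "exps A n = {m. (\<forall>x. x \<notin> A \<longrightarrow> m x = 0) \<and> sum m A = n}"

lemma finite_exps:
  assumes "finite A"
  shows "finite (exps A n)"
proof (rule finite_subset)
  show "exps A n \<subseteq> {m. \<forall>x. (x \<in> A \<longrightarrow> m x \<in> {..n}) \<and> (x \<notin> A \<longrightarrow> m x = 0)}"
    using assms by (auto simp: exps_def intro: member_le_sum)
  show "finite {m. \<forall>x. (x \<in> A \<longrightarrow> m x \<in> {..n}) \<and> (x \<notin> A \<longrightarrow> m x = 0)}"
    using assms by (intro finite_set_of_finite_funs) auto
qed

lemma exps_insert:
  assumes "finite A" "a \<notin> A"
  shows "exps (insert a A) n = (\<Union>k\<le>n. (\<lambda>m. m(a := n - k)) ` exps A k)"
proof (intro equalityI subsetI)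
  fix m assume m: "m \<in> exps (insert a A) n"
  have n: "m a + sum m A = n" using m assms by (simp add: exps_def)
  have "sum (m(a := 0)) A = sum m A"
    using assms by (intro sum.cong) auto
  then have "m(a := 0) \<in> exps A (sum m A)"
    using m by (auto simp: exps_def)
  moreover have "m = (m(a := 0))(a := n - sum m A)"
    using n by auto
  moreover have "sum m A \<le> n" using n by simp
  ultimately show "m \<in> (\<Union>k\<le>n. (\<lambda>m. m(a := n - k)) ` exps A k)" by blast
next
  fix m assume "m \<in> (\<Union>k\<le>n. (\<lambda>m. m(a := n - k)) ` exps A k)"
  then obtain k m' where k: "k \<le> n" "m' \<in> exps A k" "m = m'(a := n - k)" by auto
  have "sum m A = sum m' A"
    using assms k by (intro sum.cong) auto
  then show "m \<in> exps (insert a A) n"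
    using k assms by (auto simp: exps_def)
qed

lemma card_exps:
  assumes "finite A" "A \<noteq> {}"
  shows "card (exps A n) = (card A - 1 + n) choose n"
  using assms
proof (induction A arbitrary: n rule: finite_ne_induct)
  case (singleton a)
  have "exps {a} n = {\<lambda>x. if x = a then n else 0}" by (auto simp: exps_def)
  then show ?case by simp
next
  case (insert a A)
  have inj: "inj_on (\<lambda>m. m(a := n - k)) (exps A k)" for k
  proof (rule inj_onI)
    fix m m' assume mm: "m \<in> exps A k" "m' \<in> exps A k" "m(a := n - k) = m'(a := n - k)"
    have "m x = m' x" for x
      using mm(1,2) insert.hyps fun_cong[OF mm(3), of x] by (cases "x = a") (auto simp: exps_def)
    then show "m = m'" by auto
  qed
  have "card (exps (insert a A) n) = (\<Sum>k\<le>n. card ((\<lambda>m. m(a := n - k)) ` exps A k))"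
    unfolding exps_insert[OF insert.hyps(1,3)]
  proof (rule card_UN_disjoint)
    show "\<forall>i\<in>{..n}. \<forall>j\<in>{..n}. i \<noteq> j \<longrightarrow>
      (\<lambda>m. m(a := n - i)) ` exps A i \<inter> (\<lambda>m. m(a := n - j)) ` exps A j = {}"
    proof (intro ballI impI)
      fix i j assume ij: "i \<in> {..n}" "j \<in> {..n}" "i \<noteq> j"
      show "(\<lambda>m. m(a := n - i)) ` exps A i \<inter> (\<lambda>m. m(a := n - j)) ` exps A j = {}"
      proof (rule ccontr)
        assume "\<not> ?thesis"
        then obtain m m' where "m(a := n - i) = m'(a := n - j)" by auto
        then have "n - i = n - j" by (metis fun_upd_same)
        then show False using ij by auto
      qed
    qed
  qed (use insert finite_exps in auto)
  also have "\<dots> = (\<Sum>k\<le>n. (card A - 1 + k) choose k)"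
    using insert.IH card_image[OF inj] by simp
  \<comment> \<open>The hockey-stick identity.\<close>
  also have "\<dots> = (card (insert a A) - 1 + n) choose n"
    using insert.hyps card_gt_0_iff[of A] sum_choose_lower[of "card A - 1" n] by simp
  finally show ?case .
qed

section \<open>Polynomial counts for fibres of the truncation\<close>

lemma shifted_binomial_polynomial:
  "\<exists>P :: rat poly. \<forall>N. s \<le> N + r \<longrightarrow>
     of_nat (if s \<le> N then (r + (N - s)) choose (N - s) else 0) = poly P (of_nat N)"
proof -
  \<comment> \<open>The binomial coefficient \<open>N - s + r\<close> over \<open>r\<close> as a
    product. Its zeros are \<open>s - r, ..., s - 1\<close>, so it matches the truncated count
    already from \<open>s - r\<close> on, not only from \<open>s\<close>.\<close>
  define P :: "rat poly" where
    "P = smult (1 / fact r) (\<Prod>i=0..<r. [: of_nat r - of_nat s - of_nat i, 1 :])"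
  have P: "poly P x = (x - of_nat s + of_nat r) gchoose r" for x
    by (simp add: P_def poly_prod gbinomial_prod_rev algebra_simps)
  have "of_nat (if s \<le> N then (r + (N - s)) choose (N - s) else 0) = poly P (of_nat N)"
    if "s \<le> N + r" for N
  proof -
    have "(of_nat N - of_nat s + of_nat r :: rat) = of_nat (N + r - s)"
      using that by (simp add: of_nat_diff)
    then have *: "poly P (of_nat N) = of_nat ((N + r - s) choose r)"
      by (simp add: P binomial_gbinomial)
    show ?thesis
    proof (cases "s \<le> N")
      case True
      then have "(r + (N - s)) choose (N - s) = (N + r - s) choose r"
        using binomial_symmetric[of "N - s" "r + (N - s)"] by (simp add: add.commute)
      then show ?thesis using True * by simp
    next
      case False
      then show ?thesis using * that by (simp add: binomial_eq_0)
    qed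
  qed
  then show ?thesis by blast
qed

text \<open>A vector in the fibre agrees with \<open>c\<close> where \<open>c x < M\<close> and may
  exceed it freely on the set \<open>K\<close> where \<open>c x = M\<close>. Subtracting
  \<open>c\<close> turns the fibre into all vectors on \<open>K\<close> of degree
  \<open>N - s\<close>.\<close>

lemma card_clip_fibre_polynomial:
  fixes A :: "'a set" and c :: "'a \<Rightarrow> nat"
  assumes A: "finite A" and M: "M > 0" and c: "\<And>x. c x \<le> M" "\<And>x. x \<notin> A \<Longrightarrow> c x = 0"
  shows "\<exists>P :: rat poly. \<forall>N \<ge> card A * (M - 1) + 1.
     of_nat (card {m \<in> exps A N. (\<lambda>x. min (m x) M) = c}) = poly P (of_nat N)"
proof -
  define K where "K = {x \<in> A. c x = M}"
  define s where "s = sum c A"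
  have finK: "finite K" and KA: "K \<subseteq> A" using A by (auto simp: K_def)
  \<comment> \<open>Each coordinate contributes at most \<open>M - 1\<close>, plus one on
    \<open>K\<close>. All but one of this surplus \<open>card K\<close> is absorbed by the zeros of
    the binomial polynomial, whence the \<open>+ 1\<close> in the threshold.\<close>
  have s_le: "s \<le> card A * (M - 1) + card K"
  proof -
    have "s \<le> (\<Sum>x\<in>A. (M - 1) + (if c x = M then 1 else 0))"
      unfolding s_def
    proof (rule sum_mono)
      fix x show "c x \<le> (M - 1) + (if c x = M then 1 else 0)"
        using c(1)[of x] M by auto
    qed
    also have "\<dots> = card A * (M - 1) + card K"
      using A by (simp add: sum.distrib K_def sum.If_cases Int_def)
    finally show ?thesis .
  qed
  have fibre: "{m \<in> exps A N. (\<lambda>x. min (m x) M) = c} = 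
      (if s \<le> N then (\<lambda>f x. f x + c x) ` exps K (N - s) else {})" for N
  proof -
    have 1: "s \<le> N \<and> m \<in> (\<lambda>f x. f x + c x) ` exps K (N - s)"
      if m: "m \<in> exps A N" "(\<lambda>x. min (m x) M) = c" for m
    proof -
      have mc: "c x \<le> m x" "x \<notin> K \<Longrightarrow> m x = c x" for x
        using fun_cong[OF m(2), of x] m(1) c M by (auto simp: K_def exps_def min_def split: if_splits)
      have "sum (\<lambda>x. m x - c x) K = sum (\<lambda>x. m x - c x) A"
        using A KA mc by (intro sum.mono_neutral_left) auto
      also have "\<dots> = N - s"
        using m mc by (simp add: sum_subtractf_nat s_def exps_def)
      finally have "(\<lambda>x. m x - c x) \<in> exps K (N - s)"
        using mc by (auto simp: exps_def)
      moreover have "m = (\<lambda>x. (m x - c x) + c x)" using mc by auto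
      moreover have "s \<le> N" using m mc by (auto simp: s_def exps_def intro: sum_mono)
      ultimately show ?thesis by (intro conjI image_eqI)
    qed
    have 2: "(\<lambda>x. f x + c x) \<in> exps A N \<and> (\<lambda>x. min (f x + c x) M) = c"
      if f: "f \<in> exps K (N - s)" "s \<le> N" for f
    proof -
      have "sum f K = sum f A"
        using A KA f by (intro sum.mono_neutral_left) (auto simp: exps_def)
      then have "sum (\<lambda>x. f x + c x) A = N"
        using f by (simp add: sum.distrib s_def exps_def)
      moreover have "min (f x + c x) M = c x" for x
        using f(1) c(1)[of x] by (cases "x \<in> K") (auto simp: exps_def K_def)
      ultimately show ?thesis using f(1) KA c(2) by (auto simp: exps_def)
    qed
    show ?thesis
    proof (intro equalityI subsetI)
      fix m assume "m \<in> {m \<in> exps A N. (\<lambda>x. min (m x) M) = c}"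
      then show "m \<in> (if s \<le> N then (\<lambda>f x. f x + c x) ` exps K (N - s) else {})"
        using 1[of m] by simp
    next
      fix m assume "m \<in> (if s \<le> N then (\<lambda>f x. f x + c x) ` exps K (N - s) else {})"
      then obtain f where "s \<le> N" "f \<in> exps K (N - s)" "m = (\<lambda>x. f x + c x)"
        by (auto split: if_splits)
      then show "m \<in> {m \<in> exps A N. (\<lambda>x. min (m x) M) = c}"
        using 2[of f] by simp
    qed
  qed
  have inj: "inj_on (\<lambda>f x. f x + c x) F" for F
    by (auto simp: inj_on_def fun_eq_iff)
  show ?thesis
  proof (cases "K = {}")
    case True
    \<comment> \<open>Without free coordinates only \<open>c\<close> could lie in the fibre, and its
      degree \<open>s \<le> card A * (M - 1)\<close> is below \<open>N\<close>.\<close>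
    have "card {m \<in> exps A N. (\<lambda>x. min (m x) M) = c} = 0" if "N \<ge> card A * (M - 1) + 1" for N
      unfolding fibre using that s_le True by (auto simp: exps_def)
    then show ?thesis by (intro exI[of _ 0]) simp
  next
    case False
    obtain P :: "rat poly" where P: "\<And>N. s \<le> N + (card K - 1) \<Longrightarrow>
     of_nat (if s \<le> N then (card K - 1 + (N - s)) choose (N - s) else 0) = poly P (of_nat N)"
      using shifted_binomial_polynomial[of s "card K - 1"] by blast
    have "card {m \<in> exps A N. (\<lambda>x. min (m x) M) = c} =
        (if s \<le> N then (card K - 1 + (N - s)) choose (N - s) else 0)" for N
      unfolding fibre using card_image[OF inj] card_exps[OF finK False] by simp
    moreover have "s \<le> N + (card K - 1)" if "N \<ge> card A * (M - 1) + 1" for N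
      using that s_le False finK by (auto simp: Suc_le_eq card_gt_0_iff)
    ultimately show ?thesis using P by (intro exI[of _ P] allI impI) simp
  qed
qed

text \<open>The complement of \<open>U\<close> is a union of whole fibres, over the finitely many
  truncated vectors outside \<open>U\<close>, so the fibre polynomials add up.\<close>

lemma card_clip_invariant_polynomial:
  fixes A :: "'a set" and U :: "('a \<Rightarrow> nat) set"
  assumes A: "finite A" and M: "M > 0"
    and U: "\<And>m. (\<And>x. x \<notin> A \<Longrightarrow> m x = 0) \<Longrightarrow> m \<in> U \<longleftrightarrow> (\<lambda>x. min (m x) M) \<in> U"
  shows "\<exists>P :: rat poly. \<forall>N \<ge> card A * (M - 1) + 1.
     of_nat (card {m \<in> exps A N. m \<notin> U}) = poly P (of_nat N)"
proof -
  define C where "C = {c. \<forall>x. (x \<in> A \<longrightarrow> c x \<in> {..M}) \<and> (x \<notin> A \<longrightarrow> c x = 0)} - U"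
  have finC: "finite C"
    unfolding C_def using A by (intro finite_Diff finite_set_of_finite_funs) auto
  have cC: "c x \<le> M" "x \<notin> A \<Longrightarrow> c x = 0" if "c \<in> C" for c x
    using that by (auto simp: C_def) (metis zero_le)
  define F where "F N c = {m \<in> exps A N. (\<lambda>x. min (m x) M) = c}" for N c
  have "\<forall>c\<in>C. \<exists>P :: rat poly. \<forall>N \<ge> card A * (M - 1) + 1. of_nat (card (F N c)) = poly P (of_nat N)"
    unfolding F_def using card_clip_fibre_polynomial[OF A M] cC by blast
  then obtain P :: "_ \<Rightarrow> rat poly" where
    P: "\<And>c N. c \<in> C \<Longrightarrow> N \<ge> card A * (M - 1) + 1 \<Longrightarrow> of_nat (card (F N c)) = poly (P c) (of_nat N)"
    by metis
  have "of_nat (card {m \<in> exps A N. m \<notin> U}) = poly (\<Sum>c\<in>C. P c) (of_nat N)"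
    if N: "N \<ge> card A * (M - 1) + 1" for N
  proof -
    have clip: "(\<lambda>x. min (m x) M) \<in> C \<longleftrightarrow> m \<notin> U" if "m \<in> exps A N" for m
      using that U[of m] by (auto simp: C_def exps_def)
    have "{m \<in> exps A N. m \<notin> U} = (\<Union>c\<in>C. F N c)"
      using clip by (auto simp: F_def)
    also have "card \<dots> = (\<Sum>c\<in>C. card (F N c))"
      using finC by (intro card_UN_disjoint) (auto simp: F_def finite_exps[OF A])
    finally show ?thesis using P N by (simp add: poly_sum)
  qed
  then show ?thesis by blast
qed

text \<open>The cone of vectors whose first nonzero entry is positive, for some enumeration of \<open>A\<close>;
  it encodes a monomial order without ordering the points.\<close>

lemma exists_positive_cone:
  assumes "finite A"
  shows "\<exists>pos :: ('a \<Rightarrow> real) \<Rightarrow> bool.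
    (\<forall>u v. pos u \<longrightarrow> pos v \<longrightarrow> pos (\<lambda>x. u x + v x)) \<and>
    (\<forall>u. pos u \<longrightarrow> \<not> pos (\<lambda>x. - u x)) \<and>
    (\<forall>u. (\<exists>x\<in>A. u x \<noteq> 0) \<longrightarrow> pos u \<or> pos (\<lambda>x. - u x))"
  using assms
proof induction
  case empty
  show ?case by (intro exI[of _ "\<lambda>_. False"]) auto
next
  case (insert a A)
  then obtain pos :: "('a \<Rightarrow> real) \<Rightarrow> bool" where pos:
    "\<And>u v. pos u \<Longrightarrow> pos v \<Longrightarrow> pos (\<lambda>x. u x + v x)"
    "\<And>u. pos u \<Longrightarrow> \<not> pos (\<lambda>x. - u x)"
    "\<And>u. \<exists>x\<in>A. u x \<noteq> 0 \<Longrightarrow> pos u \<or> pos (\<lambda>x. - u x)" by blast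
  show ?case
    by (intro exI[of _ "\<lambda>u. u a > 0 \<or> (u a = 0 \<and> pos u)"]) (use pos in fastforce)
qed

section \<open>Determinants and affine bases\<close>

text \<open>Multilinearity: terms with \<open>y\<close> in two rows vanish. Its purpose is to move
  the base point of a simplex, which changes all difference rows at once.\<close>

lemma det_rows_subtract_const:
  fixes x :: "'n::finite \<Rightarrow> 'a::comm_ring_1 ^ 'n"
  shows "det (\<chi> i. x i - y) = det (\<chi> i. x i) - (\<Sum>k\<in>UNIV. det (\<chi> i. if i = k then y else x i))"
proof -
  \<comment> \<open>Once \<open>y\<close> is itself a row, subtracting it from other rows is a row
    operation.\<close>
  have clear: "det (\<chi> i. if i = k then y else if i \<in> S then x i - y else x i)
      = det (\<chi> i. if i = k then y else x i)" if "finite S" for S k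
    using that
  proof induction
    case (insert s S)
    let ?B = "\<chi> i. if i = k then y else if i \<in> S then x i - y else x i"
    show ?case
    proof (cases "s = k")
      case True
      then have "(\<chi> i. if i = k then y else if i \<in> insert s S then x i - y else x i) = ?B"
        by (auto simp: vec_eq_iff)
      then show ?thesis using insert.IH by simp
    next
      case False
      have eq: "(\<chi> i. if i = s then row s ?B + (-1) *s row k ?B else row i ?B) =
          (\<chi> i. if i = k then y else if i \<in> insert s S then x i - y else x i)"
        using False insert.hyps by (auto simp: vec_eq_iff row_def)
      show ?thesis
        using det_row_operation[OF False, where c = "-1" and A = ?B] insert.IH
        by (simp only: eq)
    qed
  qed (simp cong: if_cong)
  have "det (\<chi> i. if i \<in> S then x i - y else x i)
      = det (\<chi> i. x i) - (\<Sum>k\<in>S. det (\<chi> i. if i = k then y else x i))" if "finite S" for S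
    using that
  proof induction
    case (insert s S)
    let ?r = "\<lambda>i. if i \<in> S then x i - y else x i"
    have split: "(\<chi> i. if i \<in> insert s S then x i - y else x i) =
        (\<chi> i. if i = s then x s + (-1) *s y else ?r i)"
      by (auto simp: vec_eq_iff)
    have "(\<chi> i. if i = s then x s else ?r i) = (\<chi> i. ?r i)"
      using insert.hyps by (auto simp: vec_eq_iff)
    then show ?case
      unfolding split det_row_add[of s "\<lambda>_. x s"] det_row_mul[of s "-1" "\<lambda>_. y"]
      using insert clear[OF insert.hyps(1), of s] by simp
  qed simp
  from this[of UNIV] show ?thesis by simp
qed

abbreviation to_real_vec :: "int ^ 'd \<Rightarrow> real ^ 'd" where
  "to_real_vec x \<equiv> (\<chi> i. real_of_int (x $ i))"

lemma inj_to_real_vec: "inj to_real_vec"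
  by (auto simp: inj_def vec_eq_iff)

lemma det_of_int: "det (\<chi> i j. real_of_int (B $ i $ j)) = real_of_int (det B)"
  by (simp add: det_def)

lemma abs_det_le_vol_dagger_max:
  fixes a :: "'d::finite option \<Rightarrow> int ^ 'd"
  assumes "finite A" "inj a" "range a \<subseteq> A"
  shows "\<bar>det (\<chi> c. a (Some c) - a None)\<bar> \<le> vol_dagger_max A"
proof -
  let ?f = "\<lambda>a :: 'd option \<Rightarrow> int ^ 'd. \<bar>det (\<chi> r c. (a (Some c) - a None) $ r)\<bar>"
  have "finite {a :: 'd option \<Rightarrow> int ^ 'd. \<forall>x. (x \<in> UNIV \<longrightarrow> a x \<in> A) \<and> (x \<notin> UNIV \<longrightarrow> a x = 0)}"
    using assms by (intro finite_set_of_finite_funs) auto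
  then have "finite {a :: 'd option \<Rightarrow> int ^ 'd. inj a \<and> range a \<subseteq> A}"
    by (rule rev_finite_subset) auto
  then have "finite {?f a |a. inj a \<and> range a \<subseteq> A}"
    by (rule finite_image_set)
  moreover have "?f a \<in> {?f a |a. inj a \<and> range a \<subseteq> A}" using assms by blast
  ultimately have "?f a \<le> vol_dagger_max A"
    unfolding vol_dagger_max_def by (rule Max_ge)
  moreover have "(\<chi> r c. (a (Some c) - a None) $ r) = transpose (\<chi> c. a (Some c) - a None)"
    by (simp add: vec_eq_iff transpose_def)
  ultimately show ?thesis by (simp add: det_transpose)
qed

lemma sum_UNIV_option:
  "sum f (UNIV :: 'a::finite option set) = f None + (\<Sum>c\<in>UNIV. f (Some c))"
  by (simp add: UNIV_option_conv sum.reindex)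

lemma det_diffs_nonzero:
  fixes b :: "'d::finite option \<Rightarrow> real ^ 'd"
  assumes "inj b" "\<not> affine_dependent (range b)"
  shows "det (\<chi> c. b (Some c) - b None) \<noteq> 0"
proof
  let ?R = "\<chi> c. b (Some c) - b None"
  assume "det ?R = 0"
  then have "\<not> (\<exists>B. ?R ** B = mat 1)"
    using invertible_det_nz[of ?R] invertible_right_inverse[of ?R] by simp
  then obtain w k where w: "(\<Sum>i\<in>UNIV. w i *s row i ?R) = 0" "w k \<noteq> 0"
    unfolding matrix_right_invertible_independent_rows by blast
  \<comment> \<open>A linear dependence of the differences becomes an affine one when the base point
    gets the coefficient that makes the total zero.\<close>
  define U where "U v = (case inv b v of None \<Rightarrow> - sum w UNIV | Some c \<Rightarrow> w c)" for v
  have Ub: "U (b None) = - sum w UNIV" "U (b (Some c)) = w c" for c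
    by (simp_all add: U_def assms(1))
  have "sum U (range b) = 0"
    by (simp add: sum.reindex[OF assms(1)] sum_UNIV_option Ub)
  moreover have "row c ?R = b (Some c) - b None" for c
    by (simp add: row_def vec_eq_iff)
  then have "(\<Sum>v\<in>range b. U v *\<^sub>R v) = (\<Sum>i\<in>UNIV. w i *s row i ?R)"
    by (simp add: sum.reindex[OF assms(1)] sum_UNIV_option Ub scalar_mult_eq_scaleR
        scaleR_diff_right sum_subtractf scaleR_sum_left)
  moreover have "U (b (Some k)) \<noteq> 0" using w Ub by simp
  ultimately have "affine_dependent (range b)"
    using w by (subst affine_dependent_explicit_finite) auto
  then show False using assms by simp
qed

lemma affine_hull_eq_UNIV:
  fixes A :: "(int ^ 'd) set"
  assumes "lattice_dim (diff_lattice A) = CARD('d)"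
  shows "affine hull (to_real_vec ` A) = UNIV"
proof (cases "A = {}")
  case True
  have "x = 0" if "x \<in> diff_lattice A" for x
    using that by (simp add: diff_lattice_def True)
  then have "to_real_vec ` diff_lattice A \<subseteq> {0}"
    by (fastforce simp: vec_eq_iff)
  then have "dim (to_real_vec ` diff_lattice A) = 0"
    using dim_eq_0 by blast
  then have "CARD('d) = 0" using assms unfolding lattice_dim_def by metis
  then show ?thesis by simp
next
  case False
  then obtain a where a: "a \<in> A" by blast
  \<comment> \<open>All differences, hence the whole lattice, lie in the span of the differences
    with \<open>a\<close>, so this span has full dimension.\<close>
  let ?D = "(\<lambda>x. x - to_real_vec a) ` to_real_vec ` A"
  have D: "to_real_vec (x - y) \<in> span ?D" if "x \<in> A" "y \<in> A" for x y
  proof -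
    have "to_real_vec (x - y) = (to_real_vec x - to_real_vec a) - (to_real_vec y - to_real_vec a)"
      by (simp add: vec_eq_iff)
    also have "\<dots> \<in> span ?D"
      by (intro span_diff span_base imageI that)
    finally show ?thesis .
  qed
  have "to_real_vec x \<in> span ?D" if "x \<in> diff_lattice A" for x
    using that unfolding diff_lattice_def
  proof (induction rule: group_closure.induct)
    case (base s)
    have zero: "to_real_vec (0 :: int ^ 'd) = 0" by (simp add: vec_eq_iff)
    consider "s = 0" | x y where "s = x - y" "x \<in> A" "y \<in> A" using base by blast
    then show ?case
    proof cases
      case 1
      then show ?thesis using zero span_zero by (simp only:)
    next
      case 2
      then show ?thesis using D by blast
    qed
  next
    case (diff s t)
    have eq: "to_real_vec (s - t) = to_real_vec s - to_real_vec t"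
      by (simp add: vec_eq_iff)
    show ?case unfolding eq using diff.IH by (rule span_diff)
  qed
  then have "to_real_vec ` diff_lattice A \<subseteq> span ?D" by blast
  then have "CARD('d) \<le> dim ?D"
    using assms dim_mono unfolding lattice_dim_def by metis
  moreover have "dim ?D \<le> CARD('d)" using dim_subset_UNIV[of ?D] by simp
  moreover have "aff_dim (to_real_vec ` A) = dim ?D"
    using a by (intro aff_dim_eq_dim_subtract hull_inc) auto
  ultimately show ?thesis using aff_dim_eq_full[of "to_real_vec ` A"] by simp
qed

text \<open>The real affine basis that extends \<open>S\<close> consists of points of
  \<open>A\<close>, and by full dimension it has \<open>d + 1\<close> of them, so
  \<open>'d option\<close> can index it.\<close>

lemma exists_affine_basis:
  fixes A :: "(int ^ 'd) set"
  assumes full: "affine hull (to_real_vec ` A) = UNIV"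
    and S: "S \<subseteq> A" "\<not> affine_dependent (to_real_vec ` S)"
  obtains a :: "'d option \<Rightarrow> int ^ 'd" where
    "inj a" "S \<subseteq> range a" "range a \<subseteq> A" "\<not> affine_dependent (to_real_vec ` range a)"
    "det (\<chi> c. a (Some c) - a None) \<noteq> 0"
proof -
  obtain T where T: "\<not> affine_dependent T" "to_real_vec ` S \<subseteq> T" "T \<subseteq> to_real_vec ` A"
    "affine hull T = affine hull (to_real_vec ` A)"
    by (rule extend_to_affine_basis[OF S(2) image_mono[OF S(1)]])
  define T' where "T' = {x \<in> A. to_real_vec x \<in> T}"
  have T': "to_real_vec ` T' = T" using T unfolding T'_def by blast
  have "finite T" using T(1) aff_independent_finite by blast
  then have fin: "finite T'" 
    using T' inj_to_real_vec by (metis finite_imageD inj_on_subset subset_UNIV)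
  have "int (card T) = aff_dim T + 1" using aff_dim_affine_independent[OF T(1)] by simp
  also have "aff_dim T = CARD('d)" using T(4) full aff_dim_eq_full[of T] by simp
  finally have "card T' = card (UNIV :: 'd option set)"
    using T' card_image[OF inj_on_subset[OF inj_to_real_vec subset_UNIV], of T']
    by (simp add: card_UNIV_option)
  then obtain a :: "'d option \<Rightarrow> int ^ 'd" where a: "bij_betw a UNIV T'"
    using fin by (metis finite_class.finite_UNIV finite_same_card_bij)
  have inj: "inj a" and ran: "range a = T'" using a by (auto simp: bij_betw_def)
  let ?b = "\<lambda>i. to_real_vec (a i)"
  have "range ?b = T" using ran T' by (metis image_image)
  moreover have "inj ?b" using inj_compose[OF inj_to_real_vec inj] by (simp only: comp_def)
  ultimately have "det (\<chi> c. ?b (Some c) - ?b None) \<noteq> 0"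
    using det_diffs_nonzero T(1) by blast
  moreover have "(\<chi> c. ?b (Some c) - ?b None) =
      (\<chi> i j. real_of_int ((\<chi> c. a (Some c) - a None) $ i $ j))"
    by (simp add: vec_eq_iff)
  ultimately have "det (\<chi> c. a (Some c) - a None) \<noteq> 0"
    using det_of_int[of "\<chi> c. a (Some c) - a None"] by auto
  moreover have "S \<subseteq> range a" using T(2) S(1) ran by (auto simp: T'_def)
  ultimately show thesis
    using that inj ran T' T(1) by (auto simp: T'_def)
qed

section \<open>Conformal affine relations\<close>

text \<open>The real linear relations among the points \<open>(x, 1)\<close> with \<open>x\<close>
  in \<open>A\<close>, extended by zero.\<close>

definition affine_relation :: "(int ^ 'd) set \<Rightarrow> (int ^ 'd \<Rightarrow> real) \<Rightarrow> bool" where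
  "affine_relation A u \<longleftrightarrow> (\<forall>x. x \<notin> A \<longrightarrow> u x = 0) \<and> sum u A = 0 \<and>
     (\<Sum>x\<in>A. u x *\<^sub>R to_real_vec x) = 0"

lemma affine_relation_scale:
  "affine_relation A u \<Longrightarrow> affine_relation A (\<lambda>x. t * u x)"
  unfolding affine_relation_def
  by (auto simp flip: sum_distrib_left scaleR_scaleR scaleR_sum_right)

lemma affine_relation_diff:
  "affine_relation A u \<Longrightarrow> affine_relation A v \<Longrightarrow> affine_relation A (\<lambda>x. u x - v x)"
  unfolding affine_relation_def
  by (auto simp: sum_subtractf scaleR_diff_left)

definition supp :: "('a \<Rightarrow> real) \<Rightarrow> 'a set" where
  "supp u = {x. u x \<noteq> 0}"

text \<open>Sign-compatibility as for oriented matroids. The inclusion of supports excludes nonzero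
  entries of \<open>c\<close> where \<open>u\<close> vanishes, which the products cannot
  detect.\<close>

definition conformal :: "('a \<Rightarrow> real) \<Rightarrow> ('a \<Rightarrow> real) \<Rightarrow> bool" where
  "conformal c u \<longleftrightarrow> supp c \<subseteq> supp u \<and> (\<forall>x. 0 \<le> c x * u x)"

text \<open>Says that \<open>u = c + (u - c)\<close> is a sign-compatible decomposition; it is
  symmetric in \<open>c\<close> and \<open>u - c\<close>.\<close>

definition dominated :: "('a \<Rightarrow> real) \<Rightarrow> ('a \<Rightarrow> real) \<Rightarrow> bool" where
  "dominated c u \<longleftrightarrow> (\<forall>x. 0 \<le> c x \<and> c x \<le> u x \<or> u x \<le> c x \<and> c x \<le> 0)"

lemma affine_relation_supp: "affine_relation A u \<Longrightarrow> supp u \<subseteq> A"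
  by (auto simp: affine_relation_def supp_def)

text \<open>The ratio test of the simplex method: \<open>t\<close> is the least
  \<open>u y / w y\<close> over the coordinates where both have the same sign. No entry changes
  sign, and the minimising coordinate becomes zero.\<close>

lemma subtract_maximal_multiple:
  assumes fin: "finite (supp u)" and sub: "supp w \<subseteq> supp u" and x: "w x * u x > 0"
  obtains t where "t > 0" "\<And>y. 0 \<le> u y * (u y - t * w y)"
    "supp (\<lambda>y. u y - t * w y) \<subset> supp u"
proof -
  let ?X = "{y. w y * u y > 0}"
  define t where "t = Min ((\<lambda>y. u y / w y) ` ?X)"
  have finX: "finite ?X" using fin by (rule rev_finite_subset) (auto simp: supp_def)
  have ne: "(\<lambda>y. u y / w y) ` ?X \<noteq> {}" using x by blast
  have "t \<in> (\<lambda>y. u y / w y) ` ?X"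
    unfolding t_def by (rule Min_in) (use finX ne in auto)
  then obtain z where z: "w z * u z > 0" "t = u z / w z" by auto
  have t0: "t > 0" using z by (auto simp: zero_less_mult_iff zero_less_divide_iff)
  have sgn: "0 \<le> u y * (u y - t * w y)" for y
  proof (cases "w y * u y > 0")
    case True
    then have "t \<le> u y / w y" unfolding t_def using finX by (intro Min_le) auto
    then have "t * (w y * u y) \<le> u y / w y * (w y * u y)"
      using True by (intro mult_right_mono) auto
    also have "\<dots> = u y * u y" using True by auto
    finally show ?thesis by (simp add: algebra_simps)
  next
    case False
    then have "t * (w y * u y) \<le> 0" using t0 by (intro mult_nonneg_nonpos[of t]) auto
    moreover have "0 \<le> u y * u y" by simp
    ultimately have "t * (w y * u y) \<le> u y * u y" by linarith
    then show ?thesis by (simp add: algebra_simps)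
  qed
  have "supp (\<lambda>y. u y - t * w y) \<subseteq> supp u" using sub by (auto simp: supp_def)
  moreover have "z \<in> supp u" "z \<notin> supp (\<lambda>y. u y - t * w y)" using z by (auto simp: supp_def)
  ultimately show thesis using that t0 sgn by blast
qed

text \<open>Take a nonzero conformal relation of smallest support. A nonzero relation on a proper
  subset of it could be subtracted, keeping signs and losing a coordinate.\<close>

lemma exists_conformal_circuit:
  assumes A: "finite A" and u: "affine_relation A u" "supp u \<noteq> {}"
  obtains c where "affine_relation A c" "conformal c u" "supp c \<noteq> {}"
    "\<And>w. affine_relation A w \<Longrightarrow> supp w \<subset> supp c \<Longrightarrow> supp w = {}"
proof -
  let ?P = "\<lambda>c. affine_relation A c \<and> conformal c u \<and> supp c \<noteq> {}"
  have "?P u" using u by (auto simp: conformal_def)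
  then obtain c where c: "?P c" and minimal: "\<And>c'. ?P c' \<Longrightarrow> card (supp c) \<le> card (supp c')"
    using ex_has_least_nat[of ?P u "\<lambda>c. card (supp c)"] by blast
  have fin: "finite (supp c)"
    using c A affine_relation_supp finite_subset by blast
  have "supp w = {}" if w: "affine_relation A w" "supp w \<subset> supp c" for w
  proof (rule ccontr)
    assume "supp w \<noteq> {}"
    then obtain x where x: "w x \<noteq> 0" by (auto simp: supp_def)
    \<comment> \<open>Scaling by \<open>s\<close> makes \<open>w\<close> agree in sign with
      \<open>c\<close> at \<open>x\<close>, as the ratio test requires.\<close>
    define s where "s = w x * c x"
    have s0: "s \<noteq> 0" using x w(2) by (auto simp: s_def supp_def)
    let ?w = "\<lambda>x. s * w x"
    have sw: "supp ?w = supp w" using s0 by (auto simp: supp_def)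
    have "?w x * c x = s\<^sup>2" by (simp add: s_def power2_eq_square)
    then have "?w x * c x > 0" using s0 by simp
    then obtain t where t: "t > 0" "\<And>y. 0 \<le> c y * (c y - t * ?w y)"
      "supp (\<lambda>y. c y - t * ?w y) \<subset> supp c"
      using subtract_maximal_multiple[OF fin, of ?w x] sw w(2) by auto
    let ?v = "\<lambda>y. c y - t * ?w y"
    have "affine_relation A ?v"
      using c w by (intro affine_relation_diff affine_relation_scale) auto
    moreover have "conformal ?v u"
      unfolding conformal_def
    proof (intro conjI allI)
      show "supp ?v \<subseteq> supp u" using t(3) c by (auto simp: conformal_def)
      fix y
      show "0 \<le> ?v y * u y"
      proof (cases "c y = 0")
        case True
        then have "y \<notin> supp ?v" using t(3) by (metis (mono_tags) mem_Collect_eq psubsetD supp_def)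
        then have "?v y = 0" by (simp add: supp_def)
        then show ?thesis by simp
      next
        case False
        moreover have "0 \<le> c y * u y" using c by (simp add: conformal_def)
        ultimately show ?thesis using t(2)[of y]
          by (cases "c y > 0") (auto simp: zero_le_mult_iff)
      qed
    qed
    moreover have "supp ?v \<noteq> {}"
    proof -
      \<comment> \<open>Outside the support of \<open>w\<close> nothing was subtracted.\<close>
      obtain z where z: "z \<in> supp c" "z \<notin> supp w" using w(2) by blast
      then have "z \<in> supp ?v" by (simp add: supp_def)
      then show ?thesis by blast
    qed
    ultimately show False
      using minimal[of ?v] psubset_card_mono[OF fin t(3)] by simp
  qed
  then show thesis using that c by blast
qed

text \<open>A dependence among the remaining points, extended by zero, would be a nonzero relation
  on a proper subset of the circuit.\<close>

lemma circuit_minus_point_affine_independent: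
  assumes A: "finite A" and c: "affine_relation A c" and j: "c j \<noteq> 0"
    and circuit: "\<And>w. affine_relation A w \<Longrightarrow> supp w \<subset> supp c \<Longrightarrow> supp w = {}"
  shows "\<not> affine_dependent (to_real_vec ` (supp c - {j}))"
proof
  let ?S = "supp c - {j}"
  assume dep: "affine_dependent (to_real_vec ` ?S)"
  have SA: "?S \<subseteq> A" using affine_relation_supp[OF c] by blast
  then have fin: "finite ?S" using A finite_subset by blast
  have inj: "inj_on to_real_vec ?S" using inj_to_real_vec inj_on_subset by blast
  obtain U s where U: "sum U (to_real_vec ` ?S) = 0" "s \<in> ?S" "U (to_real_vec s) \<noteq> 0"
    "(\<Sum>v\<in>to_real_vec ` ?S. U v *\<^sub>R v) = 0"
    using dep affine_dependent_explicit_finite[OF finite_imageI[OF fin], of to_real_vec] by auto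
  define w where "w x = (if x \<in> ?S then U (to_real_vec x) else 0)" for x
  have "sum w A = sum w ?S"
    using A SA by (intro sum.mono_neutral_right) (auto simp: w_def)
  also have "\<dots> = (\<Sum>x\<in>?S. U (to_real_vec x))"
    by (intro sum.cong) (auto simp: w_def)
  finally have 1: "sum w A = 0" using U(1) sum.reindex[OF inj, of U] by simp
  have "(\<Sum>x\<in>A. w x *\<^sub>R to_real_vec x) = (\<Sum>x\<in>?S. w x *\<^sub>R to_real_vec x)"
    using A SA by (intro sum.mono_neutral_right) (auto simp: w_def)
  also have "\<dots> = (\<Sum>x\<in>?S. U (to_real_vec x) *\<^sub>R to_real_vec x)"
    by (intro sum.cong) (auto simp: w_def)
  finally have 2: "(\<Sum>x\<in>A. w x *\<^sub>R to_real_vec x) = 0"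
    using U(4) sum.reindex[OF inj, of "\<lambda>v. U v *\<^sub>R v"] by simp
  have "affine_relation A w"
    unfolding affine_relation_def using 1 2 SA by (auto simp: w_def)
  moreover have "supp w \<subset> supp c"
    using j by (auto simp: supp_def w_def)
  moreover have "s \<in> supp w" using U by (simp add: supp_def w_def)
  ultimately show False using circuit by blast
qed

lemma affine_relation_not_supported_on_independent:
  assumes A: "finite A" and c: "affine_relation A c" and sub: "supp c \<subseteq> T" and T: "T \<subseteq> A"
    and ind: "\<not> affine_dependent (to_real_vec ` T)"
  shows "supp c = {}"
proof (rule ccontr)
  assume "supp c \<noteq> {}"
  then obtain s where s: "c s \<noteq> 0" "s \<in> T" using sub by (auto simp: supp_def)
  have fin: "finite T" using T A finite_subset by blast
  have inj: "inj_on to_real_vec T" using inj_to_real_vec inj_on_subset by blast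
  define U where "U v = c (inv to_real_vec v)" for v
  have U: "U (to_real_vec x) = c x" for x unfolding U_def by (simp only: inv_f_f[OF inj_to_real_vec])
  have "sum c T = sum c A" "(\<Sum>x\<in>T. c x *\<^sub>R to_real_vec x) = (\<Sum>x\<in>A. c x *\<^sub>R to_real_vec x)"
    using A T sub by (auto intro!: sum.mono_neutral_left simp: supp_def)
  then have "sum U (to_real_vec ` T) = 0" "(\<Sum>v\<in>to_real_vec ` T. U v *\<^sub>R v) = 0"
    using c by (simp_all add: sum.reindex[OF inj] U affine_relation_def)
  moreover have "U (to_real_vec s) \<noteq> 0" using s U by simp
  ultimately have "affine_dependent (to_real_vec ` T)"
    using s fin by (subst affine_dependent_explicit_finite) auto
  then show False using ind by simp
qed

text \<open>A circuit without one point \<open>j\<close> extends to an affine basis. By Cramer's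
  rule its nonzero coefficients are, up to sign and a common factor, the determinants of the basis
  simplex and of the simplices with one vertex replaced by \<open>j\<close>. Rescaling makes them
  bounded integers.\<close>

lemma exists_bounded_conformal_relation:
  fixes A :: "(int ^ 'd) set"
  assumes A: "finite A" and full: "affine hull (to_real_vec ` A) = UNIV"
    and u: "affine_relation A u" "supp u \<noteq> {}"
  obtains c where "affine_relation A c" "conformal c u" "supp c \<noteq> {}" "\<And>x. c x \<in> \<int>"
    "\<And>x. \<bar>c x\<bar> \<le> vol_dagger_max A"
proof -
  obtain c where c: "affine_relation A c" "conformal c u" "supp c \<noteq> {}"
    and circuit: "\<And>w. affine_relation A w \<Longrightarrow> supp w \<subset> supp c \<Longrightarrow> supp w = {}"
    using exists_conformal_circuit[OF A u] by metis
  obtain j where j: "c j \<noteq> 0" using c(3) by (auto simp: supp_def)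
  have cA: "supp c \<subseteq> A" using affine_relation_supp[OF c(1)] .
  have jA: "j \<in> A" using cA j by (auto simp: supp_def)
  obtain a :: "'d option \<Rightarrow> int ^ 'd" where a: "inj a" "supp c - {j} \<subseteq> range a" "range a \<subseteq> A"
    "\<not> affine_dependent (to_real_vec ` range a)" "det (\<chi> c. a (Some c) - a None) \<noteq> 0"
    using exists_affine_basis[OF full _
        circuit_minus_point_affine_independent[OF A c(1) j circuit]] cA by blast
  \<comment> \<open>Otherwise the independent points \<open>range a\<close> would carry the nonzero
    relation \<open>c\<close>.\<close>
  have ja: "j \<notin> range a"
  proof
    assume "j \<in> range a"
    then have "supp c \<subseteq> range a" using a(2) by blast
    then show False
      using affine_relation_not_supported_on_independent[OF A c(1) _ a(3,4)] c(3) by blast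
  qed
  let ?V = "vol_dagger_max A"
  let ?D = "det (\<chi> c. a (Some c) - a None)"
  \<comment> \<open>The simplex with vertex \<open>a (Some k)\<close> replaced by
    \<open>j\<close>.\<close>
  let ?q = "\<lambda>k. det (\<chi> i. if i = k then j - a None else a (Some i) - a None)"
  have D: "\<bar>?D\<bar> \<le> ?V" using abs_det_le_vol_dagger_max[OF A a(1,3)] .
  have inj_upd: "inj (a(i := j))" for i
    using a(1) ja by (auto simp: inj_def)
  have ran_upd: "range (a(i := j)) \<subseteq> A" for i
    using a(3) jA by auto
  have q: "\<bar>?q k\<bar> \<le> ?V" for k
  proof -
    have "(\<chi> i. if i = k then j - a None else a (Some i) - a None) =
        (\<chi> i. (a(Some k := j)) (Some i) - (a(Some k := j)) None)"
      by (auto simp: vec_eq_iff)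
    then show ?thesis using abs_det_le_vol_dagger_max[OF A inj_upd ran_upd, of "Some k"] by simp
  qed
  \<comment> \<open>The simplex with base point \<open>a None\<close> replaced by
    \<open>j\<close>.\<close>
  have r: "\<bar>?D - (\<Sum>k\<in>UNIV. ?q k)\<bar> \<le> ?V"
  proof -
    have "?D - (\<Sum>k\<in>UNIV. ?q k) = det (\<chi> i. (a (Some i) - a None) - (j - a None))"
      using det_rows_subtract_const[of "\<lambda>i. a (Some i) - a None" "j - a None"] by simp
    also have "(\<chi> i. (a (Some i) - a None) - (j - a None)) =
        (\<chi> i. (a(None := j)) (Some i) - (a(None := j)) None)"
      by (simp add: vec_eq_iff)
    finally show ?thesis using abs_det_le_vol_dagger_max[OF A inj_upd ran_upd, of None] by simp
  qed
  have sum_A: "(\<Sum>x\<in>A. f x) = f j + (f (a None) + (\<Sum>k\<in>UNIV. f (a (Some k))))"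
    if "\<And>x. c x = 0 \<Longrightarrow> f x = 0" for f :: "int ^ 'd \<Rightarrow> 'v::comm_monoid_add"
  proof -
    have "(\<Sum>x\<in>A. f x) = (\<Sum>x\<in>insert j (range a). f x)"
      using A a(2,3) jA that by (intro sum.mono_neutral_right) (auto simp: supp_def)
    also have "\<dots> = f j + (\<Sum>i\<in>UNIV. f (a i))"
      using ja by (simp add: sum.reindex[OF a(1)])
    finally show ?thesis by (simp add: sum_UNIV_option)
  qed
  have rel1: "c j + (c (a None) + (\<Sum>k\<in>UNIV. c (a (Some k)))) = 0"
    using c(1) sum_A[of c] by (simp add: affine_relation_def)
  have rel2: "c j *\<^sub>R to_real_vec j + (c (a None) *\<^sub>R to_real_vec (a None) +
      (\<Sum>k\<in>UNIV. c (a (Some k)) *\<^sub>R to_real_vec (a (Some k)))) = 0"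
    using c(1) sum_A[of "\<lambda>x. c x *\<^sub>R to_real_vec x"] by (simp add: affine_relation_def)
  let ?b = "\<lambda>x. to_real_vec x - to_real_vec (a None)"
  let ?R = "\<chi> i. ?b (a (Some i))"
  have rowR: "row i ?R = ?b (a (Some i))" for i
    by (simp add: row_def vec_eq_iff)
  have c0: "c (a None) = - c j - (\<Sum>k\<in>UNIV. c (a (Some k)))" using rel1 by linarith
  have dep: "c j *\<^sub>R ?b j + (\<Sum>k\<in>UNIV. c (a (Some k)) *\<^sub>R ?b (a (Some k))) = 0"
    using rel2 unfolding c0
    by (simp add: scaleR_diff_right sum_subtractf scaleR_diff_left scaleR_sum_left algebra_simps
        del: vector_minus_component)
  \<comment> \<open>The coordinates of \<open>j - a None\<close> in the basis of differences, read
    off from \<open>dep\<close>.\<close>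
  define x where "x = (\<chi> k. - c (a (Some k)) / c j)"
  have "(\<Sum>i\<in>UNIV. x $ i *s row i ?R) = (- 1 / c j) *\<^sub>R (\<Sum>k\<in>UNIV. c (a (Some k)) *\<^sub>R ?b (a (Some k)))"
    by (simp add: x_def rowR scalar_mult_eq_scaleR scaleR_sum_right)
  also have "(\<Sum>k\<in>UNIV. c (a (Some k)) *\<^sub>R ?b (a (Some k))) = - (c j *\<^sub>R ?b j)"
    using dep by (simp add: eq_neg_iff_add_eq_0 add.commute)
  also have "(- 1 / c j) *\<^sub>R - (c j *\<^sub>R ?b j) = ?b j" using j by simp
  finally have comb: "(\<Sum>i\<in>UNIV. x $ i *s row i ?R) = ?b j" .
  have detR: "det ?R = ?D"
    unfolding det_of_int[symmetric] by (rule arg_cong[of _ _ det]) (simp add: vec_eq_iff)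
  have cramer: "real_of_int (?q k) = x $ k * ?D" for k
  proof -
    have "real_of_int (?q k) = det (\<chi> i. if i = k then ?b j else row i ?R)"
      unfolding det_of_int[symmetric] rowR by (rule arg_cong[of _ _ det]) (simp add: vec_eq_iff)
    then show ?thesis using cramer_lemma_transpose[of k x ?R] unfolding comb detR by simp
  qed
  \<comment> \<open>This factor turns the entry at \<open>j\<close> into \<open>?D\<close> up to
    sign. It is positive so that conformality survives; \<open>e\<close> records the sign.\<close>
  define t where "t = real_of_int \<bar>?D\<bar> / \<bar>c j\<bar>"
  have t0: "t > 0" using a(5) j by (simp add: t_def)
  define e where "e = sgn (real_of_int ?D) * sgn (c j)"
  have e: "e = 1 \<or> e = - 1" using a(5) j by (auto simp: e_def sgn_if)
  have te: "t = e * (?D / c j)" 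
    by (auto simp: t_def e_def abs_if sgn_if)
  have tj: "t * c j = real_of_int ?D * e" using j by (simp add: te)
  have ta: "t * c (a (Some k)) = - real_of_int (?q k) * e" for k
    unfolding cramer using j by (simp add: te x_def)
  have tn: "t * c (a None) = - real_of_int (?D - (\<Sum>k\<in>UNIV. ?q k)) * e"
    unfolding c0 by (simp add: right_diff_distrib sum_distrib_left ta tj sum_negf
        sum_distrib_right left_diff_distrib)
  have val: "\<exists>n::int. t * c y = of_int n * e \<and> \<bar>n\<bar> \<le> ?V" for y
  proof (cases "c y = 0 \<or> y = j")
    case True
    moreover have "\<bar>0\<bar> \<le> ?V" using D by linarith
    ultimately show ?thesis using tj D by (metis mult_zero_left mult_zero_right of_int_0)
  next
    case False
    then have "y \<in> range a" using a(2) by (auto simp: supp_def)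
    then obtain i where i: "y = a i" by blast
    show ?thesis
    proof (cases i)
      case None
      then show ?thesis using i tn r
        by (intro exI[of _ "- (?D - (\<Sum>k\<in>UNIV. ?q k))"]) auto
    next
      case (Some k)
      then show ?thesis using i ta[of k] q[of k] by (intro exI[of _ "- ?q k"]) auto
    qed
  qed
  show thesis
  proof (rule that[of "\<lambda>x. t * c x"])
    show "affine_relation A (\<lambda>x. t * c x)" using c(1) by (rule affine_relation_scale)
    have "supp (\<lambda>x. t * c x) = supp c" using t0 by (auto simp: supp_def)
    then show "conformal (\<lambda>x. t * c x) u" "supp (\<lambda>x. t * c x) \<noteq> {}"
      using c(2,3) t0 by (auto simp: conformal_def mult.assoc)
    fix y
    obtain n :: int where "t * c y = of_int n * e" "\<bar>n\<bar> \<le> ?V" using val by blast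
    then show "t * c y \<in> \<int>" "\<bar>t * c y\<bar> \<le> ?V"
      using e by (auto simp: abs_mult)
  qed
qed

section \<open>Splitting off integral relations step by step\<close>

lemma dominated_if_small_multiple:
  assumes "conformal c u" "0 < t" "t \<le> 1" "\<And>x. 0 \<le> u x * (u x - t * c x)"
  shows "dominated (\<lambda>x. u x - t * c x) u"
  unfolding dominated_def
proof
  fix x
  have "0 \<le> c x * u x" "u x = 0 \<Longrightarrow> c x = 0"
    using assms(1) by (auto simp: conformal_def supp_def)
  moreover have "0 \<le> c x \<Longrightarrow> 0 \<le> t * c x" "c x \<le> 0 \<Longrightarrow> t * c x \<le> 0"
    using assms(2) by (auto simp: mult_le_0_iff)
  ultimately show "0 \<le> u x - t * c x \<and> u x - t * c x \<le> u x \<or>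
      u x \<le> u x - t * c x \<and> u x - t * c x \<le> 0"
    using assms(4)[of x] by (cases "u x" "0::real" rule: linorder_cases) (auto simp: zero_le_mult_iff)
qed

text \<open>Coordinatewise, \<open>t * c\<close> lies between 0 and \<open>u\<close>, and
  \<open>c\<close> between 0 and \<open>t * c\<close>. So a step with \<open>t \<ge> 1\<close>
  splits off \<open>c\<close> itself, while by the previous lemma a smaller step leaves a dominated
  remainder.\<close>

lemma dominated_if_large_multiple:
  assumes "conformal c u" "1 \<le> t" "\<And>x. 0 \<le> u x * (u x - t * c x)"
  shows "dominated c u"
  unfolding dominated_def
proof
  fix x
  have "0 \<le> c x * u x" "u x = 0 \<Longrightarrow> c x = 0"
    using assms(1) by (auto simp: conformal_def supp_def)
  moreover have "0 \<le> c x \<Longrightarrow> c x \<le> t * c x"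
    using mult_right_mono[OF assms(2), of "c x"] by simp
  moreover have "c x \<le> 0 \<Longrightarrow> t * c x \<le> c x"
    using mult_right_mono_neg[OF assms(2), of "c x"] by simp
  ultimately show "0 \<le> c x \<and> c x \<le> u x \<or> u x \<le> c x \<and> c x \<le> 0"
    using assms(3)[of x] by (cases "u x" "0::real" rule: linorder_cases) (auto simp: zero_le_mult_iff)
qed

lemma dominated_trans: "dominated a b \<Longrightarrow> dominated b c \<Longrightarrow> dominated a c"
  unfolding dominated_def by (meson order_trans)

lemma vol_dagger_max_pos:
  fixes A :: "(int ^ 'd) set"
  assumes A: "finite A" and full: "affine hull (to_real_vec ` A) = UNIV"
  shows "0 < vol_dagger_max A"
proof -
  have "\<not> affine_dependent (to_real_vec ` {} :: (real ^ 'd) set)" by simp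
  from exists_affine_basis[OF full empty_subsetI this]
  obtain a :: "'d option \<Rightarrow> int ^ 'd" where
    "inj a" "range a \<subseteq> A" "det (\<chi> c. a (Some c) - a None) \<noteq> 0"
    by metis
  then show ?thesis using abs_det_le_vol_dagger_max[OF A, of a] by linarith
qed

text \<open>Subtract maximal multiples of bounded integral conformal relations. A coefficient of at
  least 1 yields a dominated \<open>c\<close>. Otherwise each step changes a coordinate by at most
  \<open>vol_dagger_max A\<close>, and there are at most \<open>n\<close> steps because each one
  shrinks the support.\<close>

lemma dominated_integral_relation_or_bounded:
  fixes A :: "(int ^ 'd) set"
  assumes A: "finite A" and full: "affine hull (to_real_vec ` A) = UNIV"
    and u: "affine_relation A u" "card (supp u) \<le> n"
  shows "(\<exists>c. affine_relation A c \<and> supp c \<noteq> {} \<and> dominated c u \<and> (\<forall>x. c x \<in> \<int>)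
           \<and> (\<forall>x. \<bar>c x\<bar> \<le> vol_dagger_max A))
       \<or> (\<forall>x. \<bar>u x\<bar> \<le> real n * vol_dagger_max A)"
  using u
proof (induction n arbitrary: u)
  case 0
  then have "supp u = {}"
    using affine_relation_supp A finite_subset card_0_eq by (metis le_zero_eq)
  then show ?case by (auto simp: supp_def)
next
  case (Suc n)
  let ?V = "real_of_int (vol_dagger_max A)"
  have fin: "finite (supp u)" using Suc.prems(1) affine_relation_supp A finite_subset by blast
  show ?case
  proof (cases "supp u = {}")
    case True
    moreover have "0 < ?V" using vol_dagger_max_pos[OF A full] by simp
    ultimately show ?thesis by (auto simp: supp_def)
  next
    case False
    then obtain c where c: "affine_relation A c" "conformal c u" "supp c \<noteq> {}" "\<And>x. c x \<in> \<int>"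
      "\<And>x. \<bar>c x\<bar> \<le> ?V"
      using exists_bounded_conformal_relation[OF A full Suc.prems(1)] by metis
    obtain x where x: "c x \<noteq> 0" using c(3) by (auto simp: supp_def)
    then have "u x \<noteq> 0" using c(2) by (auto simp: conformal_def supp_def)
    then have "c x * u x > 0" using x c(2) by (auto simp: conformal_def less_le)
    moreover have "supp c \<subseteq> supp u" using c(2) by (simp add: conformal_def)
    ultimately obtain t where t: "t > 0" "\<And>y. 0 \<le> u y * (u y - t * c y)"
      "supp (\<lambda>y. u y - t * c y) \<subset> supp u"
      using subtract_maximal_multiple[OF fin, of c x] by metis
    let ?v = "\<lambda>y. u y - t * c y"
    show ?thesis
    proof (cases "1 \<le> t")
      case True
      then show ?thesis using c dominated_if_large_multiple[OF c(2) _ t(2)] by blast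
    next
      case False
      have dom: "dominated ?v u" using dominated_if_small_multiple[OF c(2) t(1) _ t(2)] False by simp
      have "affine_relation A ?v"
        using c Suc.prems by (intro affine_relation_diff affine_relation_scale) auto
      moreover have "card (supp ?v) \<le> n"
        using psubset_card_mono[OF fin t(3)] Suc.prems(2) by simp
      ultimately consider (dom) c' where "affine_relation A c'" "supp c' \<noteq> {}" "dominated c' ?v"
          "\<forall>x. c' x \<in> \<int>" "\<forall>x. \<bar>c' x\<bar> \<le> ?V"
        | (bound) "\<And>x. \<bar>?v x\<bar> \<le> real n * ?V"
        using Suc.IH[of ?v] by blast
      then show ?thesis
      proof cases
        case dom
        \<comment> \<open>What splits off from the remainder also splits off from
          \<open>u\<close>.\<close>
        then show ?thesis using dominated_trans \<open>dominated ?v u\<close> by blast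
      next
        case bound
        have "\<bar>u y\<bar> \<le> real (Suc n) * ?V" for y
        proof -
          have "\<bar>t * c y\<bar> \<le> 1 * ?V"
            unfolding abs_mult using t(1) False c(5)[of y] by (intro mult_mono) auto
          then have "\<bar>u y\<bar> \<le> real n * ?V + ?V" using bound[of y] by linarith
          then show ?thesis by (simp add: algebra_simps)
        qed
        then show ?thesis by blast
      qed
    qed
  qed
qed

section \<open>Sumsets as images of exponent vectors\<close>

lemma sumset_mult_eq_image_exps:
  fixes A :: "(int ^ 'd) set"
  assumes A: "finite A"
  shows "sumset_mult N A = (\<lambda>m. \<Sum>x\<in>A. int (m x) *s x) ` exps A N"
proof (intro equalityI subsetI)
  fix s assume "s \<in> sumset_mult N A"
  then obtain a where a: "s = (\<Sum>i<N. a i)" "\<And>i. i < N \<Longrightarrow> a i \<in> A"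
    unfolding sumset_mult_def by auto
  define m where "m x = card {i. i < N \<and> a i = x}" for x
  have sub: "a ` {..<N} \<subseteq> A" using a(2) by auto
  have fibre: "(\<Sum>i | i \<in> {..<N} \<and> a i = x. a i) = int (m x) *s x" for x
    by (simp add: m_def vec_eq_iff)
  have "(\<Sum>x\<in>A. int (m x) *s x) = s"
    using sum.group[OF _ A sub, of a] a(1) fibre by simp
  moreover have "sum m A = N"
    using sum.group[OF _ A sub, of "\<lambda>_. 1 :: nat"] by (simp add: m_def)
  then have "m \<in> exps A N" using a(2) by (auto simp: exps_def m_def)
  ultimately show "s \<in> (\<lambda>m. \<Sum>x\<in>A. int (m x) *s x) ` exps A N" by blast
next
  fix s assume "s \<in> (\<lambda>m. \<Sum>x\<in>A. int (m x) *s x) ` exps A N"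
  then obtain m where "s = (\<Sum>x\<in>A. int (m x) *s x)" "m \<in> exps A N" by blast
  then show "s \<in> sumset_mult N A"
  proof (induction N arbitrary: s m)
    case 0
    then have "s = 0" using A by (auto simp: exps_def intro!: sum.neutral)
    then show ?case by (auto simp: sumset_mult_def)
  next
    case (Suc N)
    have "sum m A \<noteq> 0" using Suc.prems(2) by (simp add: exps_def)
    \<comment> \<open>Peel off one summand \<open>y\<close> that occurs, to be put back at index
      \<open>N\<close>.\<close>
    then obtain y where y: "y \<in> A" "m y > 0" by (metis gr0I sum.neutral)
    let ?m = "m(y := m y - 1)"
    have m: "m = (\<lambda>x. ?m x + of_bool (x = y))" using y by auto
    have "sum m A = sum ?m A + (\<Sum>x\<in>A. of_bool (x = y))"
      unfolding sum.distrib[symmetric] by (rule arg_cong[OF m, of "\<lambda>m. sum m A"])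
    then have "?m \<in> exps A N" using Suc.prems(2) y A by (auto simp: exps_def)
    then have "(\<Sum>x\<in>A. int (?m x) *s x) \<in> sumset_mult N A" using Suc.IH by blast
    then obtain a where a: "(\<Sum>x\<in>A. int (?m x) *s x) = (\<Sum>i<N. a i)" "\<forall>i<N. a i \<in> A"
      unfolding sumset_mult_def by auto
    have step: "int (m x) *s x = int (?m x) *s x + (if x = y then y else 0)" for x
    proof (cases "x = y")
      case True
      show ?thesis unfolding True using y(2) by (simp add: vec_eq_iff of_nat_diff Suc_leI algebra_simps)
    qed simp
    have "s = (\<Sum>x\<in>A. int (?m x) *s x + (if x = y then y else 0))"
      unfolding Suc.prems(1) by (intro sum.cong step refl)
    also have "\<dots> = (\<Sum>i<N. a i) + y"
      using a(1) y(1) A by (simp add: sum.distrib)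
    also have "\<dots> = (\<Sum>i<Suc N. (a(N := y)) i)" by simp
    finally show ?case
      unfolding sumset_mult_def using a(2) y(1)
      by (intro CollectI exI[of _ "a(N := y)"]) (auto simp: less_Suc_eq)
  qed
qed

lemma affine_relation_diff_exponents_iff:
  fixes m m' :: "int ^ 'd \<Rightarrow> nat"
  assumes "finite A" "\<And>x. x \<notin> A \<Longrightarrow> m x = 0" "\<And>x. x \<notin> A \<Longrightarrow> m' x = 0"
  shows "affine_relation A (\<lambda>x. real (m x) - real (m' x)) \<longleftrightarrow>
    sum m A = sum m' A \<and> (\<Sum>x\<in>A. int (m x) *s x) = (\<Sum>x\<in>A. int (m' x) *s x)"
proof -
  have 1: "(\<Sum>x\<in>A. real (m x) - real (m' x)) = 0 \<longleftrightarrow> sum m A = sum m' A"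
    by (simp add: sum_subtractf flip: of_nat_sum)
  have "(\<Sum>x\<in>A. (real (m x) - real (m' x)) *\<^sub>R to_real_vec x) =
      to_real_vec ((\<Sum>x\<in>A. int (m x) *s x) - (\<Sum>x\<in>A. int (m' x) *s x))"
    by (simp add: vec_eq_iff sum_subtractf left_diff_distrib)
  moreover have "to_real_vec v = 0 \<longleftrightarrow> v = 0" for v :: "int ^ 'd"
    by (simp add: vec_eq_iff)
  ultimately have "(\<Sum>x\<in>A. (real (m x) - real (m' x)) *\<^sub>R to_real_vec x) = 0 \<longleftrightarrow>
      (\<Sum>x\<in>A. int (m x) *s x) = (\<Sum>x\<in>A. int (m' x) *s x)"
    by (simp only: right_minus_eq)
  then show ?thesis using 1 assms by (simp add: affine_relation_def)
qed

section \<open>Minimal reducible exponents\<close>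

text \<open>Leading exponents of the binomials in the toric ideal of \<open>A\<close>, where \<open>pos (m - m')\<close> says that
  \<open>m'\<close> precedes \<open>m\<close> in the monomial order.\<close>

definition reducible_exps ::
  "((int ^ 'd \<Rightarrow> real) \<Rightarrow> bool) \<Rightarrow> (int ^ 'd) set \<Rightarrow> (int ^ 'd \<Rightarrow> nat) set" where
  "reducible_exps pos A = {m. (\<forall>x. x \<notin> A \<longrightarrow> m x = 0) \<and> (\<exists>m'. (\<forall>x. x \<notin> A \<longrightarrow> m' x = 0) \<and>
     affine_relation A (\<lambda>x. real (m x) - real (m' x)) \<and> pos (\<lambda>x. real (m x) - real (m' x)))}"

text \<open>The ideal property: adding \<open>k - m\<close> to both \<open>m\<close> and its partner
  leaves their difference unchanged.\<close>

lemma reducible_exps_upward_closed: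
  assumes m: "m \<in> reducible_exps pos A" and k: "\<And>x. m x \<le> k x" "\<And>x. x \<notin> A \<Longrightarrow> k x = 0"
  shows "k \<in> reducible_exps pos A"
proof -
  obtain m' where m': "\<And>x. x \<notin> A \<Longrightarrow> m' x = 0"
    "affine_relation A (\<lambda>x. real (m x) - real (m' x))" "pos (\<lambda>x. real (m x) - real (m' x))"
    using m unfolding reducible_exps_def by blast
  define h where "h x = k x - m x + m' x" for x
  have "real (k x) - real (h x) = real (m x) - real (m' x)" for x
    using k(1)[of x] by (simp add: h_def of_nat_diff)
  moreover have "h x = 0" if "x \<notin> A" for x
    using k(2) m'(1) that by (simp add: h_def)
  ultimately show ?thesis
    unfolding reducible_exps_def using m'(2,3) k(2)
    by (intro CollectI conjI exI[of _ h]) auto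
qed

text \<open>A member of least degree below \<open>m\<close> is minimal: a member below it has the
  same degree, hence the same entries.\<close>

lemma exists_minimal_reducible_exps:
  assumes A: "finite A" and m: "m \<in> reducible_exps pos A"
  obtains g where "g \<in> reducible_exps pos A" "\<And>x. g x \<le> m x"
    "\<And>h. h \<in> reducible_exps pos A \<Longrightarrow> (\<And>x. h x \<le> g x) \<Longrightarrow> h = g"
proof -
  let ?P = "\<lambda>g. g \<in> reducible_exps pos A \<and> (\<forall>x. g x \<le> m x)"
  obtain g where g: "?P g" and least: "\<And>h. ?P h \<Longrightarrow> sum g A \<le> sum h A"
    using ex_has_least_nat[of ?P m "\<lambda>g. sum g A"] m by auto
  have "h = g" if h: "h \<in> reducible_exps pos A" "\<And>x. h x \<le> g x" for h
  proof -
    have "?P h" using h g order_trans by blast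
    then have eq: "sum h A = sum g A" using least[of h] h(2) by (intro antisym[OF sum_mono]) auto
    have "h x = g x" for x
    proof (cases "x \<in> A")
      case True
      then show ?thesis using sum_mono_inv[OF eq] h(2) A by blast
    next
      case False
      then show ?thesis using h(1) g by (simp add: reducible_exps_def)
    qed
    then show ?thesis by blast
  qed
  then show thesis using that g by blast
qed

text \<open>Keeps the cone of \<open>exists_positive_cone\<close> abstract. Additivity gives
  transitivity of the order on exponents, and \<open>pos_total\<close> makes distinct exponents on
  \<open>A\<close> comparable.\<close>

locale positive_cone =
  fixes A :: "(int ^ 'd) set" and pos :: "(int ^ 'd \<Rightarrow> real) \<Rightarrow> bool"
  assumes finite_A: "finite A"
    and pos_add: "\<And>u v. pos u \<Longrightarrow> pos v \<Longrightarrow> pos (\<lambda>x. u x + v x)"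
    and pos_asym: "\<And>u. pos u \<Longrightarrow> \<not> pos (\<lambda>x. - u x)"
    and pos_total: "\<And>u. \<exists>x\<in>A. u x \<noteq> 0 \<Longrightarrow> pos u \<or> pos (\<lambda>x. - u x)"
begin

lemma not_pos_zero: "\<not> pos (\<lambda>x. 0)"
  using pos_asym[of "\<lambda>x. 0"] by auto

text \<open>The positive part \<open>h\<close> of \<open>w\<close> is reducible, with the negative
  part as partner, and lies below \<open>g\<close>, so \<open>h = g\<close> by minimality. Thus the
  only positive integral relation that can split off from \<open>u\<close> is \<open>u\<close>
  itself.\<close>

lemma positive_dominated_relation_eq:
  assumes g: "\<And>h. h \<in> reducible_exps pos A \<Longrightarrow> (\<And>x. h x \<le> g x) \<Longrightarrow> h = g"
    and u: "affine_relation A u" "\<And>x. u x \<le> real (g x)"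
    and w: "affine_relation A w" "\<And>x. w x \<in> \<int>" "dominated w u" "pos w"
  shows "w = u" "real (g x) = max (w x) 0"
proof -
  define h h' where "h x = nat \<lfloor>w x\<rfloor>" and "h' x = nat \<lfloor>- w x\<rfloor>" for x
  have floor: "real_of_int \<lfloor>w x\<rfloor> = w x" "real_of_int \<lfloor>- w x\<rfloor> = - w x" for x
    using w(2)[of x] by (auto elim!: Ints_cases simp flip: of_int_minus)
  have h: "real (h x) = max (w x) 0" "real (h' x) = max (- w x) 0" for x
    using floor[of x] unfolding h_def h'_def max_def by auto
  have "(\<lambda>x. real (h x) - real (h' x)) = w" by (auto simp: h)
  moreover have "h x = 0" "h' x = 0" if "x \<notin> A" for x
    using w(1) that by (auto simp: affine_relation_def h_def h'_def)
  ultimately have "h \<in> reducible_exps pos A"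
    unfolding reducible_exps_def using w by auto
  moreover have wu: "max (w x) 0 \<le> max (u x) 0" for x
    using w(3) by (auto simp: dominated_def max_def) (smt (verit))
  have ug: "max (u x) 0 \<le> real (g x)" for x using u(2)[of x] by simp
  have "h x \<le> g x" for x
    using wu[of x] ug[of x] h(1)[of x] by linarith
  ultimately have "h = g" using g by blast
  then have gw: "real (g x) = max (w x) 0" for x using h by simp
  then show "real (g x) = max (w x) 0" .
  \<comment> \<open>The positive parts of \<open>w\<close> and \<open>u\<close> both equal
    \<open>g\<close>, and domination gives \<open>u \<le> w\<close> at negative entries. A
    nonnegative difference with sum zero vanishes.\<close>
  have nonneg: "0 \<le> w x - u x" for x
    using wu[of x] ug[of x] gw[of x] w(3) unfolding dominated_def max_def by (smt (verit))
  moreover have "(\<Sum>x\<in>A. w x - u x) = 0"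
    using u(1) w(1) by (simp add: affine_relation_def sum_subtractf)
  ultimately have "w x - u x = 0" if "x \<in> A" for x
    using sum_nonneg_eq_0_iff[OF finite_A, of "\<lambda>x. w x - u x"] that by blast
  moreover have "w x = u x" if "x \<notin> A" for x
    using u(1) w(1) that by (simp add: affine_relation_def)
  ultimately show "w = u" by (metis eq_iff_diff_eq_0 ext)
qed

text \<open>Let \<open>u\<close> be the difference of \<open>g\<close> and its partner. Either the
  dichotomy bounds \<open>u\<close> directly, or a bounded integral \<open>c\<close> splits off from
  \<open>u\<close>, and minimality forces \<open>c = u\<close>.\<close>

lemma minimal_reducible_exps_le:
  assumes full: "affine hull (to_real_vec ` A) = UNIV" and gU: "g \<in> reducible_exps pos A"
    and g: "\<And>h. h \<in> reducible_exps pos A \<Longrightarrow> (\<And>x. h x \<le> g x) \<Longrightarrow> h = g"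
  shows "real (g x) \<le> real (card A) * vol_dagger_max A"
proof -
  let ?V = "vol_dagger_max A"
  obtain m' where m': "affine_relation A (\<lambda>x. real (g x) - real (m' x))"
    "pos (\<lambda>x. real (g x) - real (m' x))"
    using gU unfolding reducible_exps_def by blast
  define u where "u = (\<lambda>x. real (g x) - real (m' x))"
  have u: "affine_relation A u" "pos u" "\<And>x. u x \<le> real (g x)" "\<And>x. u x \<in> \<int>"
    using m' by (auto simp: u_def)
  have dom_u: "dominated u u" by (auto simp: dominated_def)
  have V: "0 < ?V" using vol_dagger_max_pos[OF finite_A full] .
  have "A \<noteq> {}" using full by auto
  then have "1 \<le> real (card A)" using finite_A by (simp add: Suc_le_eq card_gt_0_iff)
  then have VV: "?V \<le> real (card A) * ?V"
    using mult_right_mono[of 1 "real (card A)" ?V] V by simp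
  have bound: "\<bar>u y\<bar> \<le> real (card A) * ?V" for y
  proof -
    have "card (supp u) \<le> card A"
      using card_mono[OF finite_A affine_relation_supp[OF u(1)]] .
    then consider (dom) c where "affine_relation A c" "supp c \<noteq> {}" "dominated c u"
        "\<And>x. c x \<in> \<int>" "\<And>x. \<bar>c x\<bar> \<le> ?V"
      | (bound) "\<And>x. \<bar>u x\<bar> \<le> real (card A) * ?V"
      using dominated_integral_relation_or_bounded[OF finite_A full u(1)] by blast
    then show ?thesis
    proof cases
      case (dom c)
      have "\<exists>x\<in>A. c x \<noteq> 0" using dom(1,2) affine_relation_supp by (fastforce simp: supp_def)
      then consider "pos c" | "pos (\<lambda>x. - c x)" using pos_total by blast
      then have "c = u"
      proof cases
        case 1
        then show ?thesis using positive_dominated_relation_eq(1)[OF g u(1,3) dom(1,4,3)] by blast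
      next
        case 2
        \<comment> \<open>If \<open>- c\<close> is positive, then so is the complementary part
          \<open>u - c\<close>. It must then equal \<open>u\<close>, although \<open>c\<close> is
          nonzero.\<close>
        let ?d = "\<lambda>x. u x - c x"
        have "pos ?d" using pos_add[OF u(2) 2] by simp
        moreover have "affine_relation A ?d" using u(1) dom(1) by (rule affine_relation_diff)
        moreover have "dominated ?d u" using dom(3) by (fastforce simp: dominated_def)
        moreover have "?d x \<in> \<int>" for x using u(4) dom(4) by (rule Ints_diff)
        ultimately have "?d = u" using positive_dominated_relation_eq(1)[OF g u(1,3)] by blast
        then have "c x = 0" for x using fun_cong[of ?d u x] by simp
        then show ?thesis using dom(2) by (simp add: supp_def)
      qed
      then show ?thesis using dom(5)[of y] VV by simp
    next
      case bound
      then show ?thesis by blast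
    qed
  qed
  \<comment> \<open>Applied to \<open>u\<close> itself: a minimal \<open>g\<close> shares nothing
    with its partner.\<close>
  have "real (g x) = max (u x) 0"
    using positive_dominated_relation_eq(2)[OF g u(1,3,1,4) dom_u u(2)] by blast
  then show ?thesis using bound[of x] by linarith
qed

text \<open>Each point of the sumset has exactly one irreducible representation of degree
  \<open>N\<close>, the least one. Of two distinct representations the larger is reducible, and a
  partner of the least one would be a smaller representation.\<close>

lemma card_sumset_mult_eq_card_irreducible:
  "card (sumset_mult N A) = card {m \<in> exps A N. m \<notin> reducible_exps pos A}"
proof -
  let ?r = "\<lambda>m. \<Sum>x\<in>A. int (m x) *s x"
  have rel: "affine_relation A (\<lambda>x. real (m x) - real (m' x))"
    if "m \<in> exps A N" "m' \<in> exps A N" "?r m = ?r m'" for m m'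
    using that affine_relation_diff_exponents_iff[OF finite_A, of m m'] by (simp add: exps_def)
  have inj: "inj_on ?r {m \<in> exps A N. m \<notin> reducible_exps pos A}"
  proof (rule inj_onI, rule ccontr)
    fix m m' assume m: "m \<in> {m \<in> exps A N. m \<notin> reducible_exps pos A}"
      "m' \<in> {m \<in> exps A N. m \<notin> reducible_exps pos A}" "?r m = ?r m'" "m \<noteq> m'"
    let ?u = "\<lambda>x. real (m x) - real (m' x)"
    obtain x where "m x \<noteq> m' x" using m(4) by blast
    moreover have "x \<in> A"
      using m(1,2) calculation by (auto simp: exps_def) (metis)
    ultimately have "pos ?u \<or> pos (\<lambda>x. - ?u x)" by (intro pos_total) auto
    then have "pos (\<lambda>x. real (m x) - real (m' x)) \<or> pos (\<lambda>x. real (m' x) - real (m x))"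
      by simp
    then show False
      using m rel[of m m'] rel[of m' m] by (auto simp: reducible_exps_def exps_def)
  qed
  have "sumset_mult N A \<subseteq> ?r ` {m \<in> exps A N. m \<notin> reducible_exps pos A}"
  proof
    fix s assume "s \<in> sumset_mult N A"
    then have ne: "{m \<in> exps A N. ?r m = s} \<noteq> {}" (is "?F \<noteq> {}")
      using sumset_mult_eq_image_exps[OF finite_A, of N] by auto
    let ?R = "\<lambda>m m'. pos (\<lambda>x. real (m' x) - real (m x))"
    have "asymp_on ?F ?R"
      by (rule asymp_onI) (use pos_asym in fastforce)
    moreover have "transp_on ?F ?R"
    proof (rule transp_onI)
      fix m m' m'' assume "?R m m'" "?R m' m''"
      from pos_add[OF this] show "?R m m''" by simp
    qed
    ultimately obtain m where m: "m \<in> ?F" "\<forall>m'\<in>?F. m' \<noteq> m \<longrightarrow> \<not> ?R m' m"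
      using Finite_Set.bex_min_element[of ?F ?R] ne finite_exps[OF finite_A] by auto
    have "m \<notin> reducible_exps pos A"
    proof
      assume "m \<in> reducible_exps pos A"
      then obtain m' where m': "\<And>x. x \<notin> A \<Longrightarrow> m' x = 0"
        "affine_relation A (\<lambda>x. real (m x) - real (m' x))" "?R m' m"
        unfolding reducible_exps_def by blast
      have "sum m A = sum m' A \<and> ?r m = ?r m'"
        using m' m(1) affine_relation_diff_exponents_iff[OF finite_A, of m m']
        by (auto simp: exps_def)
      then have "m' \<in> ?F" using m(1) m'(1) by (auto simp: exps_def)
      moreover have "m' \<noteq> m" using m'(3) not_pos_zero by auto
      ultimately show False using m(2) m'(3) by blast
    qed
    then show "s \<in> ?r ` {m \<in> exps A N. m \<notin> reducible_exps pos A}" using m(1) by blast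
  qed
  then have "sumset_mult N A = ?r ` {m \<in> exps A N. m \<notin> reducible_exps pos A}"
    using sumset_mult_eq_image_exps[OF finite_A, of N] by blast
  then show ?thesis using card_image[OF inj] by simp
qed

text \<open>A minimal member below \<open>m\<close> has entries at most \<open>M\<close>, so it also
  lies below the truncation of \<open>m\<close>; upward closure does the rest.\<close>

lemma reducible_exps_clip:
  assumes full: "affine hull (to_real_vec ` A) = UNIV"
    and M: "real M = real (card A) * vol_dagger_max A" and m: "\<And>x. x \<notin> A \<Longrightarrow> m x = 0"
  shows "m \<in> reducible_exps pos A \<longleftrightarrow> (\<lambda>x. min (m x) M) \<in> reducible_exps pos A"
proof
  assume "m \<in> reducible_exps pos A"
  then obtain g where g: "g \<in> reducible_exps pos A" "\<And>x. g x \<le> m x"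
    "\<And>h. h \<in> reducible_exps pos A \<Longrightarrow> (\<And>x. h x \<le> g x) \<Longrightarrow> h = g"
    using exists_minimal_reducible_exps[OF finite_A, of m] by metis
  have "g x \<le> M" for x
    using minimal_reducible_exps_le[OF full g(1,3), of x] M by simp
  then show "(\<lambda>x. min (m x) M) \<in> reducible_exps pos A"
    using reducible_exps_upward_closed[OF g(1)] g(2) m by simp
next
  assume "(\<lambda>x. min (m x) M) \<in> reducible_exps pos A"
  then show "m \<in> reducible_exps pos A"
    by (rule reducible_exps_upward_closed) (use m in auto)
qed

end

section \<open>The bound on the Khovanskii threshold\<close>

theorem mainTheorem1:
  fixes A :: "(int ^ 'd) set"
  assumes "finite A"
    and "lattice_dim (diff_lattice A) = CARD('d)"
  shows "int (khovanskii_threshold A)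
           \<le> (int (card A))\<^sup>2 * vol_dagger_max A - int (card A) + 1"
proof -
  obtain pos :: "(int ^ 'd \<Rightarrow> real) \<Rightarrow> bool" where "positive_cone A pos"
    using exists_positive_cone[OF assms(1)] assms(1) unfolding positive_cone_def by metis
  then interpret positive_cone A pos .
  have full: "affine hull (to_real_vec ` A) = UNIV" using affine_hull_eq_UNIV[OF assms(2)] .
  have V: "0 < vol_dagger_max A" using vol_dagger_max_pos[OF finite_A full] .
  have "A \<noteq> {}" using full by auto
  then have card: "0 < card A" using finite_A by (simp add: card_gt_0_iff)
  \<comment> \<open>\<open>nat\<close> loses nothing because the maximal determinant is positive.
    With this \<open>M\<close>, expanding \<open>?N\<close> gives exactly the claimed bound.\<close>
  define M where "M = card A * nat (vol_dagger_max A)"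
  have M: "0 < M" "real M = real (card A) * vol_dagger_max A"
    using V card by (auto simp: M_def)
  let ?N = "card A * (M - 1) + 1"
  have "\<exists>P :: rat poly. \<forall>N\<ge>?N. of_nat (card (sumset_mult N A)) = poly P (of_nat N)"
    unfolding card_sumset_mult_eq_card_irreducible
    by (rule card_clip_invariant_polynomial[OF finite_A M(1) reducible_exps_clip[OF full M(2)]])
  then have "khovanskii_threshold A \<le> ?N"
    unfolding khovanskii_threshold_def by (intro Least_le) auto
  then have "int (khovanskii_threshold A) \<le> int ?N" by (simp only: of_nat_le_iff)
  also have "int ?N = int (card A) * (int (card A) * vol_dagger_max A - 1) + 1"
    using M(1) V by (simp add: of_nat_diff M_def)
  finally show ?thesis by (simp add: algebra_simps power2_eq_square)
qed

end
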